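(* Let $(X,d)$ be a compact metric space and let $\mathbb{F}=\{f_1,f_2,\dots,f_n\}$ be a finite family of continuous surjective maps $f_i:X\to X$. Then the non-autonomous system $(X,\mathbb{F})$ is topologically mixing if and only if the autonomous system $(X,\,f_n\circ f_{n-1}\circ\cdots\circ f_1)$ is topologically mixing.
   Context: The non-autonomous system generated by the finite ordered family $\mathbb{F}=\{f_1,\dots,f_n\}$ is obtained by repeating the maps cyclically: for every $k\ge1$ put $f_k=f_{1+((k-1)\bmod n)}$, and let $\omega_k=f_k\circ f_{k-1}\circ\cdots\circ f_1$. The system $(X,\mathbb{F})$ is topologically mixing if for every pair of non-empty open sets $U,V\subseteq X$ there exists a positive integer $K$ such that $\omega_k(U)\cap V\neq\emptyset$ for all $k\ge K$. An autonomous system $(X,g)$ is topologically mixing if for every pair of non-empty open sets $U,V\subseteq X$ there exists a positive integer $K$ such that $g^k(U)\cap V\neq\emptyset$ for all $k\ge K$. *)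

theory Defs
  imports "HOL-Analysis.Analysis"
begin

text \<open>Families of maps are indexed from 1; the value at index 0 is never used.\<close>

definition cyclic_family :: "nat \<Rightarrow> (nat \<Rightarrow> 'a \<Rightarrow> 'a) \<Rightarrow> nat \<Rightarrow> 'a \<Rightarrow> 'a" where
  "cyclic_family n f k = f (1 + (k - 1) mod n)"

text \<open>\<open>compose_upto F k\<close> is \<open>F k \<circ> F (k - 1) \<circ> \<dots> \<circ> F 1\<close>.\<close>

primrec compose_upto :: "(nat \<Rightarrow> 'a \<Rightarrow> 'a) \<Rightarrow> nat \<Rightarrow> 'a \<Rightarrow> 'a" where
  "compose_upto F 0 = id"
| "compose_upto F (Suc k) = F (Suc k) \<circ> compose_upto F k"

definition nonautonomous_mixing :: "'a topology \<Rightarrow> nat \<Rightarrow> (nat \<Rightarrow> 'a \<Rightarrow> 'a) \<Rightarrow> bool" where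
  "nonautonomous_mixing T n f \<longleftrightarrow>
     (\<forall>U V. openin T U \<and> U \<noteq> {} \<and> openin T V \<and> V \<noteq> {} \<longrightarrow>
        (\<exists>K>0. \<forall>k\<ge>K. compose_upto (cyclic_family n f) k ` U \<inter> V \<noteq> {}))"

definition autonomous_mixing :: "'a topology \<Rightarrow> ('a \<Rightarrow> 'a) \<Rightarrow> bool" where
  "autonomous_mixing T g \<longleftrightarrow>
     (\<forall>U V. openin T U \<and> U \<noteq> {} \<and> openin T V \<and> V \<noteq> {} \<longrightarrow>
        (\<exists>K>0. \<forall>k\<ge>K. (g ^^ k) ` U \<inter> V \<noteq> {}))"

end

theory Submission
  imports Defs
begin

text \<open>Write \<open>g\<close> for the composition of one full cycle. Then \<open>\<omega>\<^bsub>mn+r\<^esub> = \<omega>\<^sub>r \<circ> g\<^sup>m\<close>. Along the multiples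
  of \<open>n\<close> mixing of the non-autonomous system is therefore mixing of \<open>g\<close>. Conversely, \<open>\<omega>\<^bsub>mn+r\<^esub>(U)\<close>
  meets \<open>V\<close> as soon as \<open>g\<^sup>m(U)\<close> meets the preimage of \<open>V\<close> under \<open>\<omega>\<^sub>r\<close>, which is open and non-empty,
  and only the finitely many residues \<open>r < n\<close> have to be handled.\<close>

lemma cyclic_family_add_mult:
  assumes "r < n"
  shows "cyclic_family n f (Suc (m * n + r)) = f (Suc r)"
  using assms by (simp add: cyclic_family_def)

text \<open>After a multiple of \<open>n\<close> the cycle starts afresh, so the next
  \<open>r\<close> maps are \<open>f 1\<close>, ..., \<open>f r\<close>. The map \<open>h\<close> is
  kept abstract so that an induction hypothesis can supply it, and \<open>r = n\<close> is allowed
  so that a full cycle can be completed.\<close>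

lemma compose_upto_cyclic_family_add:
  assumes "compose_upto (cyclic_family n f) (m * n) = h" and "r \<le> n"
  shows "compose_upto (cyclic_family n f) (m * n + r) = compose_upto f r \<circ> h"
  using assms(2)
  by (induction r) (simp_all add: assms(1) cyclic_family_add_mult comp_assoc)

text \<open>The case \<open>r = n\<close> of the preceding lemma appends one full cycle, which is
  the induction step.\<close>

lemma compose_upto_cyclic_family_mult:
  "compose_upto (cyclic_family n f) (m * n) = compose_upto f n ^^ m"
proof (induction m)
  case (Suc m)
  then show ?case
    using compose_upto_cyclic_family_add[OF Suc.IH order_refl] by (simp add: add.commute)
qed simp

lemma continuous_map_compose_upto:
  assumes "\<And>i. i \<in> {1..r} \<Longrightarrow> continuous_map T T (f i)"
  shows "continuous_map T T (compose_upto f r)"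
  using assms by (induction r) (auto intro!: continuous_map_compose)

lemma image_compose_upto:
  assumes "\<And>i. i \<in> {1..r} \<Longrightarrow> f i ` X = X"
  shows "compose_upto f r ` X = X"
  using assms
proof (induction r)
  case (Suc r)
  then have "compose_upto f r ` X = X" and "f (Suc r) ` X = X"
    by simp_all
  then show ?case
    by (simp only: compose_upto.simps image_comp [symmetric])
qed simp

lemma autonomous_mixing_compose_upto:
  assumes "nonautonomous_mixing T n f" and "n \<ge> 1"
  shows "autonomous_mixing T (compose_upto f n)"
  unfolding autonomous_mixing_def
proof (intro allI impI)
  fix U V
  assume "openin T U \<and> U \<noteq> {} \<and> openin T V \<and> V \<noteq> {}"
  with assms(1) obtain K where "K > 0"
    and K: "\<And>k. k \<ge> K \<Longrightarrow> compose_upto (cyclic_family n f) k ` U \<inter> V \<noteq> {}"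
    unfolding nonautonomous_mixing_def by meson
  have "(compose_upto f n ^^ k) ` U \<inter> V \<noteq> {}" if "k \<ge> K" for k
  proof -
    \<comment> \<open>Since \<open>n \<ge> 1\<close>, passing to multiples of \<open>n\<close> only
      increases the time, so the same \<open>K\<close> serves.\<close>
    have "k * n \<ge> K"
      using mult_le_mono[OF that assms(2)] by simp
    then show ?thesis
      using K[of "k * n"] unfolding compose_upto_cyclic_family_mult by blast
  qed
  with \<open>K > 0\<close> show "\<exists>K>0. \<forall>k\<ge>K. (compose_upto f n ^^ k) ` U \<inter> V \<noteq> {}"
    by blast
qed

lemma nonautonomous_mixing_compose_upto:
  assumes mix: "autonomous_mixing T (compose_upto f n)" and "n \<ge> 1"
    and cont: "\<And>i. i \<in> {1..n} \<Longrightarrow> continuous_map T T (f i)"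
    and surj: "\<And>i. i \<in> {1..n} \<Longrightarrow> f i ` topspace T = topspace T"
  shows "nonautonomous_mixing T n f"
  unfolding nonautonomous_mixing_def
proof (intro allI impI)
  fix U V
  assume UV: "openin T U \<and> U \<noteq> {} \<and> openin T V \<and> V \<noteq> {}"
  define W where "W r = {x \<in> topspace T. compose_upto f r x \<in> V}" for r
  have "\<exists>K. \<forall>m\<ge>K. (compose_upto f n ^^ m) ` U \<inter> W r \<noteq> {}" if "r < n" for r
  proof -
    have "continuous_map T T (compose_upto f r)"
      using that by (intro continuous_map_compose_upto cont) auto
    then have "openin T (W r)"
      using UV openin_continuous_map_preimage unfolding W_def by blast
    moreover have "W r \<noteq> {}"
    proof -
      obtain v where "v \<in> V"
        using UV by blast
      \<comment> \<open>Surjectivity enters here: it gives \<open>v\<close> a preimage, which is a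
        point of \<open>W r\<close>.\<close>
      moreover have "compose_upto f r ` topspace T = topspace T"
        using that by (intro image_compose_upto surj) auto
      ultimately have "v \<in> compose_upto f r ` topspace T"
        using UV openin_subset[of T V] by auto
      with \<open>v \<in> V\<close> show ?thesis
        unfolding W_def by blast
    qed
    ultimately show ?thesis
      using mix UV unfolding autonomous_mixing_def by meson
  qed
  then obtain K where K: "\<And>r m. r < n \<Longrightarrow> m \<ge> K r \<Longrightarrow> (compose_upto f n ^^ m) ` U \<inter> W r \<noteq> {}"
    by metis
  \<comment> \<open>The sum dominates every \<open>K r\<close> and so is a threshold for all
    residues at once; \<open>Suc\<close> keeps \<open>M * n\<close> positive even if every
    \<open>K r\<close> is 0.\<close>
  define M where "M = Suc (\<Sum>r<n. K r)"
  have "compose_upto (cyclic_family n f) k ` U \<inter> V \<noteq> {}" if "k \<ge> M * n" for k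
  proof -
    have r: "k mod n < n"
      using \<open>n \<ge> 1\<close> by simp
    have "K (k mod n) \<le> (\<Sum>r<n. K r)"
      using r by (intro member_le_sum) auto
    also have "\<dots> \<le> M"
      by (simp add: M_def)
    also have "M \<le> k div n"
      using that \<open>n \<ge> 1\<close> by (simp add: less_eq_div_iff_mult_less_eq)
    finally obtain u where "u \<in> U" "(compose_upto f n ^^ (k div n)) u \<in> W (k mod n)"
      using K[OF r] by blast
    \<comment> \<open>Division with remainder: \<open>k div n\<close> full cycles, then the first
      \<open>k mod n\<close> maps, which carry \<open>W (k mod n)\<close> into
      \<open>V\<close>.\<close>
    moreover have "compose_upto (cyclic_family n f) k =
        compose_upto f (k mod n) \<circ> (compose_upto f n ^^ (k div n))"
      using compose_upto_cyclic_family_add[OF compose_upto_cyclic_family_mult less_imp_le[OF r],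
          of f "k div n"] by simp
    ultimately show ?thesis
      unfolding W_def by auto
  qed
  moreover have "M * n > 0"
    using \<open>n \<ge> 1\<close> by (simp add: M_def)
  ultimately show "\<exists>K>0. \<forall>k\<ge>K. compose_upto (cyclic_family n f) k ` U \<inter> V \<noteq> {}"
    by blast
qed

theorem lemma13:
  fixes X :: "'a set" and d :: "'a \<Rightarrow> 'a \<Rightarrow> real"
    and n :: nat and f :: "nat \<Rightarrow> 'a \<Rightarrow> 'a"
  assumes "Metric_space X d"
    and "compact_space (Metric_space.mtopology X d)"
    and "n \<ge> 1"
    and "\<And>i. i \<in> {1..n} \<Longrightarrow>
           continuous_map (Metric_space.mtopology X d) (Metric_space.mtopology X d) (f i)"
    and "\<And>i. i \<in> {1..n} \<Longrightarrow> f i ` X = X"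
  shows "nonautonomous_mixing (Metric_space.mtopology X d) n f \<longleftrightarrow>
         autonomous_mixing (Metric_space.mtopology X d) (compose_upto f n)"
proof -
  have "topspace (Metric_space.mtopology X d) = X"
    using assms(1) by (rule Metric_space.topspace_mtopology)
  with assms(5) have surj:
    "f i ` topspace (Metric_space.mtopology X d) = topspace (Metric_space.mtopology X d)"
    if "i \<in> {1..n}" for i
    using that by simp
  show ?thesis
  proof
    show "autonomous_mixing (Metric_space.mtopology X d) (compose_upto f n)"
      if "nonautonomous_mixing (Metric_space.mtopology X d) n f"
      using that assms(3) by (rule autonomous_mixing_compose_upto)
    show "nonautonomous_mixing (Metric_space.mtopology X d) n f"
      if "autonomous_mixing (Metric_space.mtopology X d) (compose_upto f n)"
      using that assms(3,4) surj by (rule nonautonomous_mixing_compose_upto)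
  qed
qed

end
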